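(* Let $K\in\mathbb{R}^{m\times n}$ and let $u_{lim},\omega_{max}>0$. The matrix inequality $$\left(\begin{array}{cc} -Q_3 & -Q_3K^T\\ \star & -\frac{u_{lim}^2}{\omega_{max}^2}I\end{array}\right)<0$$ is feasible (in the symmetric matrix $Q_3=P^{-1}>0$) if and only if the following inequality is feasible for some $0<\epsilon_3<1$, some symmetric $X_3>0$ and some square matrix $G_3\in\mathbb{R}^{n\times n}$: $$\left(\begin{array}{ccc} X_3 & 0 & -X_3\\ \star & -\frac{u_{lim}^2}{\omega_{max}^2}I & 0\\ \star & \star & 0\end{array}\right)+\mathbf{He}(\mathcal{Q}^TG_3\mathcal{P})<0,$$ where $\mathcal{P}=[\,I\quad 0\quad -2\epsilon_3 I\,]$ and $\mathcal{Q}=[\,-I\quad -K^T\quad I\,]$.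
   Context: $\mathbf{He}(A)=A+A^T$. The symbol $\star$ denotes entries determined by symmetry. For symmetric matrices, $M>0$ ($M<0$) means positive (negative) definite; $G_3$ need not be symmetric. $\mathcal{P}$ and $\mathcal{Q}$ are partitioned conformally with the $3\times3$ block matrix (block sizes $n,m,n$). *)

theory Defs
  imports "HOL-Analysis.Analysis"
begin

(* Definiteness includes symmetry: M > 0 and M < 0 are only used for symmetric matrices. *)

definition pos_def :: "real ^ 'k ^ 'k \<Rightarrow> bool" where
  "pos_def M \<longleftrightarrow> transpose M = M \<and> (\<forall>x. x \<noteq> 0 \<longrightarrow> x \<bullet> (M *v x) > 0)"

definition neg_def :: "real ^ 'k ^ 'k \<Rightarrow> bool" where
  "neg_def M \<longleftrightarrow> transpose M = M \<and> (\<forall>x. x \<noteq> 0 \<longrightarrow> x \<bullet> (M *v x) < 0)"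

definition He :: "real ^ 'k ^ 'k \<Rightarrow> real ^ 'k ^ 'k" where
  "He A = A + transpose A"

(* In real ^ 'c ^ 'r the rows are indexed by 'r and the columns by 'c. A block structure
   is a sum type of indices; three blocks are nested to the right as 'p + 'q + 's. *)

definition hcat :: "real ^ 'p ^ 'r \<Rightarrow> real ^ 'q ^ 'r \<Rightarrow> real ^ ('p + 'q) ^ 'r" where
  "hcat A B = (\<chi> i j. case j of Inl p \<Rightarrow> A $ i $ p | Inr q \<Rightarrow> B $ i $ q)"

definition vcat :: "real ^ 'c ^ 'p \<Rightarrow> real ^ 'c ^ 'q \<Rightarrow> real ^ 'c ^ ('p + 'q)" where
  "vcat A B = (\<chi> i j. case i of Inl p \<Rightarrow> A $ p $ j | Inr q \<Rightarrow> B $ q $ j)"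

(* [A  B; star  D], where star is the transpose of B *)
definition sym_block2 ::
    "real ^ 'p ^ 'p \<Rightarrow> real ^ 'q ^ 'p \<Rightarrow> real ^ 'q ^ 'q \<Rightarrow> real ^ ('p + 'q) ^ ('p + 'q)" where
  "sym_block2 A B D = vcat (hcat A B) (hcat (transpose B) D)"

(* [A  B  C; star  D  E; star  star  F] *)
definition sym_block3 ::
    "real ^ 'p ^ 'p \<Rightarrow> real ^ 'q ^ 'p \<Rightarrow> real ^ 's ^ 'p \<Rightarrow>
     real ^ 'q ^ 'q \<Rightarrow> real ^ 's ^ 'q \<Rightarrow> real ^ 's ^ 's \<Rightarrow>
     real ^ ('p + 'q + 's) ^ ('p + 'q + 's)" where
  "sym_block3 A B C D E F = sym_block2 A (hcat B C) (sym_block2 D E F)"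

definition calP :: "real \<Rightarrow> real ^ ('n + 'm::finite + 'n) ^ 'n" where
  "calP \<epsilon> = hcat (mat 1) (hcat 0 (- ((2 * \<epsilon>) *\<^sub>R mat 1)))"

definition calQ :: "real ^ 'n ^ 'm \<Rightarrow> real ^ ('n + 'm + 'n) ^ 'n" where
  "calQ K = hcat (- mat 1) (hcat (- transpose K) (mat 1))"

end

theory Submission
  imports Defs
begin

text \<open>
  Write \<open>c\<close> for the quotient \<open>u_lim\<^sup>2 / \<omega>_max\<^sup>2\<close>. Both matrices are symmetric, so everything rests on
  comparing two quadratic forms. With one and the same matrix \<open>X\<close> playing the role of \<open>Q\<^sub>3\<close> in the
  first inequality and of \<open>X\<^sub>3\<close> in the second, they are

    \<open>s(x, y) = - x\<^sup>TXx - 2 x\<^sup>TXK\<^sup>Ty - c |y|\<^sup>2\<close> and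

    \<open>l(x, y, z) = x\<^sup>TXx - 2 x\<^sup>TXz - c |y|\<^sup>2 + 2 (z - x - K\<^sup>Ty)\<^sup>TG(x - 2\<epsilon>z)\<close>.

  The summand with the multiplier \<open>G\<close> vanishes on the kernel of \<open>calQ K\<close>, that is, for
  \<open>z = x + K\<^sup>Ty\<close>, and there \<open>l(x, y, z) = s(x, y)\<close>, whatever \<open>G\<close> and \<open>\<epsilon>\<close> are
  (\<open>three_block_form_on_kernel_calQ\<close>). Hence negativity of \<open>l\<close> gives negativity of \<open>s\<close>.

  Conversely, a multiplier is usually produced by the projection lemma, but here it can be named:
  for \<open>\<epsilon> = 1/2\<close> the second factor of the multiplier term is \<open>x - z\<close>, and the choice \<open>G = X\<close> turns
  the form into \<open>l(x, y, z) = s(x - z, y) - z\<^sup>TXz\<close>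
  (\<open>three_block_form_eq_two_block_minus_square\<close>). This is negative unless \<open>x - z\<close>, \<open>y\<close> and \<open>z\<close> all
  vanish.

  That a positive definite \<open>Q\<^sub>3\<close> is the inverse of some positive definite \<open>P\<close> is \<open>pos_def_matrix_inv\<close>.
\<close>

section \<open>Block vectors\<close>

text \<open>
  The column vectors on which \<open>hcat\<close> and \<open>vcat\<close> matrices act: with every vector split into its
  blocks, the quadratic form of a block matrix becomes an explicit expression in the blocks.
\<close>

definition vjoin :: "'a ^ 'p \<Rightarrow> 'a ^ 'q \<Rightarrow> 'a ^ ('p + 'q)" where
  "vjoin x y = (\<chi> i. case i of Inl p \<Rightarrow> x $ p | Inr q \<Rightarrow> y $ q)"

lemma vjoin_nth [simp]: "vjoin x y $ Inl p = x $ p" "vjoin x y $ Inr q = y $ q"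
  by (simp_all add: vjoin_def)

lemma vjoin_cases: obtains x y where "v = vjoin x y"
proof
  show "v = vjoin (\<chi> p. v $ Inl p) (\<chi> q. v $ Inr q)"
    by (auto simp: vjoin_def vec_eq_iff split: sum.splits)
qed

lemma vjoin_eq_0_iff [simp]:
  fixes x :: "('a::zero) ^ 'p" and y :: "'a ^ 'q"
  shows "vjoin x y = 0 \<longleftrightarrow> x = 0 \<and> y = 0"
proof
  assume "vjoin x y = 0"
  then have "vjoin x y $ i = 0" for i by simp
  then have "x $ p = 0" "y $ q = 0" for p q
    using vjoin_nth[of x y] by metis+
  then show "x = 0 \<and> y = 0" by (simp add: vec_eq_iff)
qed (auto simp: vjoin_def vec_eq_iff split: sum.splits)

lemma sum_UNIV_sum:
  fixes f :: "'p::finite + 'q::finite \<Rightarrow> 'b::comm_monoid_add"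
  shows "(\<Sum>i\<in>UNIV. f i) = (\<Sum>p\<in>UNIV. f (Inl p)) + (\<Sum>q\<in>UNIV. f (Inr q))"
  by (simp add: UNIV_Plus_UNIV[symmetric] sum.Plus del: UNIV_Plus_UNIV)

lemma inner_vjoin [simp]:
  fixes x x' :: "real ^ 'p" and y y' :: "real ^ 'q"
  shows "vjoin x y \<bullet> vjoin x' y' = x \<bullet> x' + y \<bullet> y'"
  by (simp add: inner_vec_def sum_UNIV_sum)

lemma hcat_mult_vjoin [simp]: "hcat A B *v vjoin x y = A *v x + B *v y"
  by (simp add: vec_eq_iff matrix_vector_mult_def hcat_def sum_UNIV_sum)

lemma vcat_mult_vec [simp]: "vcat A B *v x = vjoin (A *v x) (B *v x)"
  by (auto simp: vec_eq_iff matrix_vector_mult_def vcat_def vjoin_def split: sum.splits)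

section \<open>Quadratic forms\<close>

text \<open>
  The forms are computed by moving a transposed factor to the other side of the inner product, so
  \<open>transpose A *v x\<close> must not be rewritten to \<open>x v* A\<close>.
\<close>

declare transpose_matrix_vector [simp del]

lemma inner_transpose_mult_vec:
  fixes A :: "real ^ 'c ^ 'r"
  shows "x \<bullet> (transpose A *v y) = (A *v x) \<bullet> y"
  by (metis dot_lmul_matrix inner_commute transpose_matrix_vector)

lemma minus_mult_vec [simp]:
  fixes A :: "real ^ 'c ^ 'r"
  shows "(- A) *v x = - (A *v x)"
  by (simp add: vec_eq_iff matrix_vector_mult_def sum_negf)

lemma transpose_sym_block2:
  assumes "transpose A = A" "transpose D = D"
  shows "transpose (sym_block2 A B D) = sym_block2 A B D"
proof -
  have "A $ i $ j = A $ j $ i" "D $ k $ l = D $ l $ k" for i j k l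
    using assms by (simp_all add: transpose_def vec_eq_iff)
  then show ?thesis
    by (auto simp: sym_block2_def vcat_def hcat_def transpose_def vec_eq_iff split: sum.splits)
qed

lemma transpose_He: "transpose (He A) = He A"
  by (simp add: He_def transpose_def vec_eq_iff add.commute)

lemma transpose_add: "transpose (A + B) = transpose A + transpose B"
  by (simp add: transpose_def vec_eq_iff)

lemma transpose_neg_scaled_mat: "transpose (- (c *\<^sub>R mat 1)) = - (c *\<^sub>R (mat 1 :: real ^ 'k ^ 'k))"
  by (simp add: transpose_def mat_def vec_eq_iff)

lemma quadratic_form_sym_block2:
  "vjoin x y \<bullet> (sym_block2 A B D *v vjoin x y) = x \<bullet> (A *v x) + 2 * (x \<bullet> (B *v y)) + y \<bullet> (D *v y)"
  by (simp add: sym_block2_def inner_transpose_mult_vec inner_add_right inner_commute)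

text \<open>
  Only the symmetric part of a matrix contributes to its quadratic form.
\<close>

lemma quadratic_form_He:
  fixes A :: "real ^ 'k ^ 'k"
  shows "v \<bullet> (He A *v v) = 2 * (v \<bullet> (A *v v))"
  by (simp add: He_def matrix_vector_mult_add_rdistrib inner_add_right
      inner_transpose_mult_vec inner_commute)

lemma matrix_inv_unique:
  fixes A B :: "real ^ 'k ^ 'k"
  assumes "A ** B = mat 1" "B ** A = mat 1"
  shows "matrix_inv A = B"
proof -
  have "A ** matrix_inv A = mat 1"
    unfolding matrix_inv_def using assms by (metis (mono_tags, lifting) someI_ex)
  then have "B ** (A ** matrix_inv A) = B" by simp
  then show ?thesis by (simp add: matrix_mul_assoc assms)
qed

text \<open>
  A positive definite \<open>X\<close> has trivial kernel, so it is invertible; substituting \<open>x = Xw\<close> turns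
  \<open>x\<^sup>TX\<^sup>-\<^sup>1x\<close> into \<open>w\<^sup>TXw\<close>. The second claim lets a given \<open>Q\<^sub>3\<close> be presented as the inverse of
  \<open>P = Q\<^sub>3\<^sup>-\<^sup>1\<close>.
\<close>

lemma pos_def_matrix_inv:
  fixes X :: "real ^ 'k ^ 'k"
  assumes "pos_def X"
  shows "pos_def (matrix_inv X)" "matrix_inv (matrix_inv X) = X"
proof -
  have sym: "transpose X = X" and pos: "\<And>x. x \<noteq> 0 \<Longrightarrow> x \<bullet> (X *v x) > 0"
    using assms by (auto simp: pos_def_def)
  have "x = 0" if "X *v x = 0" for x
    using pos[of x] that by force
  then obtain B where B: "B ** X = mat 1"
    using matrix_left_invertible_ker[of X] by blast
  then have B': "X ** B = mat 1"
    by (simp add: matrix_left_right_inverse)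
  have inv: "matrix_inv X = B"
    by (rule matrix_inv_unique) (use B B' in auto)
  have "matrix_inv B = X"
    by (rule matrix_inv_unique) (use B B' in auto)
  then show "matrix_inv (matrix_inv X) = X"
    by (simp add: inv)
  have "transpose B = transpose B ** (X ** B)"
    by (simp add: B')
  also have "\<dots> = transpose (X ** B) ** B"
    by (simp add: matrix_transpose_mul matrix_mul_assoc sym)
  finally have "transpose B = B"
    by (simp add: B' transpose_mat)
  moreover have "x \<bullet> (B *v x) > 0" if "x \<noteq> 0" for x
  proof -
    have x: "X *v (B *v x) = x"
      by (simp add: matrix_vector_mul_assoc B')
    then have "B *v x \<noteq> 0" using that by auto
    from pos[OF this] show ?thesis by (simp add: x inner_commute)
  qed
  ultimately show "pos_def (matrix_inv X)"
    by (simp add: inv pos_def_def)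
qed

section \<open>The two inequalities\<close>

lemma quadratic_form_two_block:
  fixes K :: "real ^ 'n ^ 'm" and Q :: "real ^ 'n ^ 'n"
  shows
  "vjoin x y \<bullet> (sym_block2 (- Q) (- (Q ** transpose K)) (- (c *\<^sub>R mat 1)) *v vjoin x y)
   = - (x \<bullet> (Q *v x)) - 2 * (x \<bullet> (Q *v (transpose K *v y))) - c * (y \<bullet> y)"
  by (simp add: quadratic_form_sym_block2 matrix_vector_mul_assoc[symmetric]
      scaleR_matrix_vector_assoc[symmetric])

lemma quadratic_form_three_block:
  fixes K :: "real ^ 'n ^ 'm" and X G :: "real ^ 'n ^ 'n"
  shows "vjoin x (vjoin y z) \<bullet> ((sym_block3 X 0 (- X) (- (c *\<^sub>R mat 1)) 0 0
            + He (transpose (calQ K) ** G ** calP \<epsilon>)) *v vjoin x (vjoin y z))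
   = x \<bullet> (X *v x) - 2 * (x \<bullet> (X *v z)) - c * (y \<bullet> y)
     + 2 * ((z - x - transpose K *v y) \<bullet> (G *v (x - (2 * \<epsilon>) *\<^sub>R z)))"
proof -
  have "calP \<epsilon> *v vjoin x (vjoin y z) = x - (2 * \<epsilon>) *\<^sub>R z"
    by (simp add: calP_def scaleR_matrix_vector_assoc[symmetric])
  moreover have "calQ K *v vjoin x (vjoin y z) = z - x - transpose K *v y"
    by (simp add: calQ_def)
  ultimately show ?thesis
    by (simp add: sym_block3_def matrix_vector_mult_add_rdistrib inner_add_right quadratic_form_He
        quadratic_form_sym_block2 matrix_vector_mul_assoc[symmetric] inner_transpose_mult_vec
        scaleR_matrix_vector_assoc[symmetric])
qed

text \<open>
  The third block of \<open>v x y\<close> is chosen so that \<open>calQ K\<close> annihilates \<open>v x y\<close>, which removes \<open>G\<close>;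
  the remaining terms combine by \<open>x\<^sup>TXx - 2 x\<^sup>TX(x + K\<^sup>Ty) = - x\<^sup>TXx - 2 x\<^sup>TXK\<^sup>Ty\<close>.
\<close>

lemma three_block_form_on_kernel_calQ:
  fixes K :: "real ^ 'n ^ 'm" and X G :: "real ^ 'n ^ 'n"
  defines "v x y \<equiv> vjoin x (vjoin y (x + transpose K *v y))"
  shows "v x y \<bullet> ((sym_block3 X 0 (- X) (- (c *\<^sub>R mat 1)) 0 0
            + He (transpose (calQ K) ** G ** calP \<epsilon>)) *v v x y)
    = vjoin x y \<bullet> (sym_block2 (- X) (- (X ** transpose K)) (- (c *\<^sub>R mat 1)) *v vjoin x y)"
  by (simp add: v_def quadratic_form_three_block quadratic_form_two_block matrix_vector_right_distrib
      inner_add_right)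

text \<open>
  Put \<open>p = x - z\<close>. Symmetry of \<open>X\<close> gives \<open>x\<^sup>TXx - 2 x\<^sup>TXz = p\<^sup>TXp - z\<^sup>TXz\<close>, and for \<open>\<epsilon> = 1/2\<close> and
  \<open>G = X\<close> the multiplier term is \<open>- 2 (p + K\<^sup>Ty)\<^sup>TXp\<close>. In the sum \<open>p\<^sup>TXp\<close> changes sign, which is
  what makes the form negative.
\<close>

lemma three_block_form_eq_two_block_minus_square:
  fixes K :: "real ^ 'n ^ 'm" and X :: "real ^ 'n ^ 'n"
  assumes "transpose X = X"
  shows "vjoin x (vjoin y z) \<bullet> ((sym_block3 X 0 (- X) (- (c *\<^sub>R mat 1)) 0 0
            + He (transpose (calQ K) ** X ** calP (1/2))) *v vjoin x (vjoin y z))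
    = vjoin (x - z) y \<bullet>
        (sym_block2 (- X) (- (X ** transpose K)) (- (c *\<^sub>R mat 1)) *v vjoin (x - z) y)
      - z \<bullet> (X *v z)"
proof -
  have sym: "a \<bullet> (X *v b) = b \<bullet> (X *v a)" for a b
    by (metis assms inner_commute inner_transpose_mult_vec)
  show ?thesis
    by (simp add: quadratic_form_three_block quadratic_form_two_block matrix_vector_mult_diff_distrib
        inner_diff_left inner_diff_right sym[of z x] sym[of "transpose K *v y"])
qed

theorem theorem3:
  fixes K :: "real ^ 'n ^ 'm" and u_lim \<omega>_max :: real
  assumes "u_lim > 0" and "\<omega>_max > 0"
  shows
    "(\<exists>P Q\<^sub>3 :: real ^ 'n ^ 'n.
        pos_def P \<and> Q\<^sub>3 = matrix_inv P \<and> pos_def Q\<^sub>3 \<and>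
        neg_def (sym_block2
          (- Q\<^sub>3) (- (Q\<^sub>3 ** transpose K))
                (- ((u_lim\<^sup>2 / \<omega>_max\<^sup>2) *\<^sub>R mat 1)))) \<longleftrightarrow>
     (\<exists>(\<epsilon>\<^sub>3 :: real) (X\<^sub>3 :: real ^ 'n ^ 'n) (G\<^sub>3 :: real ^ 'n ^ 'n).
        0 < \<epsilon>\<^sub>3 \<and> \<epsilon>\<^sub>3 < 1 \<and> pos_def X\<^sub>3 \<and>
        neg_def (sym_block3
            X\<^sub>3 0                                            (- X\<^sub>3)
               (- ((u_lim\<^sup>2 / \<omega>_max\<^sup>2) *\<^sub>R mat 1)) 0
                                                             0
          + He (transpose (calQ K) ** G\<^sub>3 ** calP \<epsilon>\<^sub>3)))"
proof -
  define c where "c = u_lim\<^sup>2 / \<omega>_max\<^sup>2"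
  let ?S = "\<lambda>Q :: real ^ 'n ^ 'n. sym_block2 (- Q) (- (Q ** transpose K)) (- (c *\<^sub>R mat 1))"
  let ?L = "\<lambda>(X :: real ^ 'n ^ 'n) G \<epsilon>. sym_block3 X 0 (- X) (- (c *\<^sub>R mat 1)) 0 0
              + He (transpose (calQ K) ** G ** calP \<epsilon>)"
  have three_block_neg: "neg_def (?L Q Q (1/2))" if Q: "pos_def Q" and S: "neg_def (?S Q)" for Q
    unfolding neg_def_def
  proof (intro conjI allI impI)
    have sym: "transpose Q = Q" and pos: "\<And>z. z \<noteq> 0 \<Longrightarrow> 0 < z \<bullet> (Q *v z)"
      using Q by (simp_all add: pos_def_def)
    have "transpose (0 :: real ^ 'n ^ 'n) = 0"
      by (simp add: transpose_def vec_eq_iff)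
    then show "transpose (?L Q Q (1/2)) = ?L Q Q (1/2)"
      by (simp add: sym_block3_def transpose_add transpose_He transpose_sym_block2 sym
          transpose_neg_scaled_mat)
    fix v :: "real ^ ('n + 'm + 'n)"
    assume "v \<noteq> 0"
    moreover obtain x y z where v: "v = vjoin x (vjoin y z)"
      by (metis vjoin_cases)
    ultimately have "vjoin (x - z) y \<noteq> 0 \<or> z \<noteq> 0"
      by auto
    moreover have "vjoin (x - z) y \<noteq> 0 \<Longrightarrow> vjoin (x - z) y \<bullet> (?S Q *v vjoin (x - z) y) < 0"
      using S unfolding neg_def_def by blast
    ultimately show "v \<bullet> (?L Q Q (1/2) *v v) < 0"
      unfolding v three_block_form_eq_two_block_minus_square[OF sym] using pos[of z]
      by (cases "z = 0"; cases "vjoin (x - z) y = 0") (simp_all del: vjoin_eq_0_iff inner_vjoin)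
  qed
  have two_block_neg: "neg_def (?S X)" if X: "pos_def X" and L: "neg_def (?L X G \<epsilon>)" for X G \<epsilon>
    unfolding neg_def_def
  proof (intro conjI allI impI)
    have "transpose X = X"
      using X by (simp add: pos_def_def)
    then have "transpose (- X) = - X"
      by (simp add: transpose_def vec_eq_iff)
    then show "transpose (?S X) = ?S X"
      by (simp add: transpose_sym_block2 transpose_neg_scaled_mat)
    fix w :: "real ^ ('n + 'm)"
    assume "w \<noteq> 0"
    moreover obtain x y where w: "w = vjoin x y"
      by (rule vjoin_cases)
    ultimately have "vjoin x (vjoin y (x + transpose K *v y)) \<noteq> 0"
      by auto
    then show "w \<bullet> (?S X *v w) < 0"
      using L unfolding w neg_def_def three_block_form_on_kernel_calQ[symmetric, where G = G and \<epsilon> = \<epsilon>]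
      by blast
  qed
  show ?thesis
    unfolding c_def[symmetric]
  proof
    assume "\<exists>P Q. pos_def P \<and> Q = matrix_inv P \<and> pos_def Q \<and> neg_def (?S Q)"
    then obtain Q where Q: "pos_def Q" "neg_def (?S Q)"
      by blast
    show "\<exists>\<epsilon> X G. 0 < \<epsilon> \<and> \<epsilon> < 1 \<and> pos_def X \<and> neg_def (?L X G \<epsilon>)"
      by (rule exI[of _ "1/2"], rule exI[of _ Q], rule exI[of _ Q])
         (use Q three_block_neg in simp)
  next
    assume "\<exists>\<epsilon> X G. 0 < \<epsilon> \<and> \<epsilon> < 1 \<and> pos_def X \<and> neg_def (?L X G \<epsilon>)"
    then obtain X where X: "pos_def X" "neg_def (?S X)"
      using two_block_neg by blast
    then show "\<exists>P Q. pos_def P \<and> Q = matrix_inv P \<and> pos_def Q \<and> neg_def (?S Q)"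
      using pos_def_matrix_inv[OF X(1)] by metis
  qed
qed

end
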